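(* Let $U_1, \dots, U_k$ be finite-dimensional vector spaces over $\mathbb{F}_p$, let $c > 0$ and let $\alpha : U_1 \times\cdots\times U_k \to \mathbb{F}_p$ be a multilinear form with $\operatorname{bias}\alpha \geq c$. Let $\varepsilon > 0$. Then there exist a nonnegative integer $m \leq 2^{25}\varepsilon^{-14}c^{-14}$, coefficients $c_1, \dots, c_m \in \mathbb{C}$ with $\sum_{i \in [m]} |c_i| \leq c^{-1}$, and multiaffine forms $\lambda_1, \dots, \lambda_m : U_1 \times\cdots\times U_k \to \mathbb{F}_p$ with vanishing multilinear part such that \[\Big\| \chi \circ \alpha - \sum_{i \in [m]} c_i \chi \circ \lambda_i\Big\|_{L^2} \leq \varepsilon.\]
   Context: $p$ is a prime and $\chi(a) = \exp(2\pi i a/p)$ for $a \in \mathbb{F}_p$. For a multilinear form $\alpha$ on $U_1\times\cdots\times U_k$, $\operatorname{bias}\alpha = \frac{1}{|U_1|\cdots|U_k|}\sum_{x_1\in U_1,\dots,x_k\in U_k}\chi(\alpha(x_1,\dots,x_k))$. A multiaffine form is a map $U_1\times\cdots\times U_k\to\mathbb{F}_p$ that is affine in each variable separately; equivalently it can be written as $\sum_{I\subseteq[k]}\beta_I(x_I)$ where each $\beta_I$ is multilinear in the variables $x_i$, $i\in I$ (with $\beta_\emptyset$ a constant). The term $\beta_{[k]}$ is uniquely determined and is called the multilinear part; "vanishing multilinear part" means $\beta_{[k]} = 0$. For $f : X \to \mathbb{C}$ on a finite set, $\|f\|_{L^2} = \big(\frac{1}{|X|}\sum_{x\in X}|f(x)|^2\big)^{1/2}$.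 *)

theory Defs
  imports
    "HOL-Analysis.Analysis"
    "HOL-Library.Complex_Order"
    "Berlekamp_Zassenhaus.Finite_Field"
begin

text \<open>
  The field with \<open>p\<close> elements is \<open>'p mod_ring\<close> with \<open>'p :: prime_card\<close>, so \<open>p = CARD('p)\<close>.
  The spaces \<open>U i\<close> are subspaces of one ambient vector space over this field, of arbitrary type
  and dimension. Any finite family of vector spaces embeds into such an ambient space (their direct
  sum), so this loses no generality; the \<open>U i\<close> need not be independent or distinct. The product of
  the \<open>U i\<close> over an index set \<open>I\<close> is \<open>PiE I U\<close>, and forms are only constrained on that set.
\<close>

definition chi :: "'p::prime_card mod_ring \<Rightarrow> complex" where
  "chi a = exp (2 * of_real pi * \<i> * of_int (to_int_mod_ring a) / of_nat CARD('p))"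

definition finite_dimensional_subspace ::
    "('p::prime_card mod_ring \<Rightarrow> 'v::ab_group_add \<Rightarrow> 'v) \<Rightarrow> 'v set \<Rightarrow> bool" where
  "finite_dimensional_subspace smul S \<longleftrightarrow>
     module.subspace smul S \<and> (\<exists>B. finite B \<and> B \<subseteq> S \<and> module.span smul B = S)"

definition linear_form_on ::
    "('p::prime_card mod_ring \<Rightarrow> 'v::ab_group_add \<Rightarrow> 'v) \<Rightarrow> 'v set \<Rightarrow> ('v \<Rightarrow> 'p mod_ring) \<Rightarrow> bool"
  where
  "linear_form_on smul S f \<longleftrightarrow>
     (\<forall>x\<in>S. \<forall>y\<in>S. f (x + y) = f x + f y) \<and> (\<forall>a. \<forall>x\<in>S. f (smul a x) = a * f x)"

definition affine_form_on ::
    "('p::prime_card mod_ring \<Rightarrow> 'v::ab_group_add \<Rightarrow> 'v) \<Rightarrow> 'v set \<Rightarrow> ('v \<Rightarrow> 'p mod_ring) \<Rightarrow> bool"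
  where
  "affine_form_on smul S f \<longleftrightarrow>
     (\<exists>g c. linear_form_on smul S g \<and> (\<forall>x\<in>S. f x = g x + c))"

text \<open>For \<open>I = {}\<close> the product is a single point and every function is a multilinear form, as
  required of the constant term of a multiaffine form.\<close>

definition multilinear_form ::
    "('p::prime_card mod_ring \<Rightarrow> 'v::ab_group_add \<Rightarrow> 'v) \<Rightarrow> nat set \<Rightarrow> (nat \<Rightarrow> 'v set)
      \<Rightarrow> ((nat \<Rightarrow> 'v) \<Rightarrow> 'p mod_ring) \<Rightarrow> bool" where
  "multilinear_form smul I U f \<longleftrightarrow>
     (\<forall>i\<in>I. \<forall>x\<in>PiE I U. linear_form_on smul (U i) (\<lambda>y. f (x(i := y))))"

definition multiaffine_form ::
    "('p::prime_card mod_ring \<Rightarrow> 'v::ab_group_add \<Rightarrow> 'v) \<Rightarrow> nat set \<Rightarrow> (nat \<Rightarrow> 'v set)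
      \<Rightarrow> ((nat \<Rightarrow> 'v) \<Rightarrow> 'p mod_ring) \<Rightarrow> bool" where
  "multiaffine_form smul I U f \<longleftrightarrow>
     (\<forall>i\<in>I. \<forall>x\<in>PiE I U. affine_form_on smul (U i) (\<lambda>y. f (x(i := y))))"

definition multilinear_decomposition ::
    "('p::prime_card mod_ring \<Rightarrow> 'v::ab_group_add \<Rightarrow> 'v) \<Rightarrow> nat set \<Rightarrow> (nat \<Rightarrow> 'v set)
      \<Rightarrow> ((nat \<Rightarrow> 'v) \<Rightarrow> 'p mod_ring) \<Rightarrow> (nat set \<Rightarrow> (nat \<Rightarrow> 'v) \<Rightarrow> 'p mod_ring) \<Rightarrow> bool" where
  "multilinear_decomposition smul I U f \<beta> \<longleftrightarrow>
     (\<forall>J. J \<subseteq> I \<longrightarrow> multilinear_form smul J U (\<beta> J)) \<and>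
     (\<forall>x\<in>PiE I U. f x = (\<Sum>J\<in>Pow I. \<beta> J (restrict x J)))"

text \<open>The top term \<open>\<beta> I\<close> of a decomposition is determined by \<open>f\<close> on \<open>PiE I U\<close>, so it does not
  matter which decomposition witnesses that it vanishes.\<close>

definition vanishing_multilinear_part ::
    "('p::prime_card mod_ring \<Rightarrow> 'v::ab_group_add \<Rightarrow> 'v) \<Rightarrow> nat set \<Rightarrow> (nat \<Rightarrow> 'v set)
      \<Rightarrow> ((nat \<Rightarrow> 'v) \<Rightarrow> 'p mod_ring) \<Rightarrow> bool" where
  "vanishing_multilinear_part smul I U f \<longleftrightarrow>
     (\<exists>\<beta>. multilinear_decomposition smul I U f \<beta> \<and> (\<forall>x\<in>PiE I U. \<beta> I x = 0))"

definition bias ::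
    "nat set \<Rightarrow> (nat \<Rightarrow> 'v set) \<Rightarrow> ((nat \<Rightarrow> 'v) \<Rightarrow> 'p::prime_card mod_ring) \<Rightarrow> complex" where
  "bias I U f = (\<Sum>x\<in>PiE I U. chi (f x)) / (\<Prod>i\<in>I. of_nat (card (U i)))"

definition L2_norm :: "'a set \<Rightarrow> ('a \<Rightarrow> complex) \<Rightarrow> real" where
  "L2_norm X f = sqrt ((\<Sum>x\<in>X. (cmod (f x))\<^sup>2) / real (card X))"

end

theory Submission
  imports Defs
begin

text \<open>
  Since the product space is invariant under translation by \<open>x\<close>, the average over \<open>y\<close> of
  \<open>\<chi> (\<alpha> (x + y))\<close> is the bias \<open>b\<close> for every \<open>x\<close>. Conjugating and multiplying by \<open>\<chi> (\<alpha> x)\<close> shows that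
  \<open>\<chi> \<circ> \<alpha>\<close> is exactly \<open>1 / b\<close> times the average over \<open>y\<close> of the functions
  \<open>x \<mapsto> \<chi> (\<alpha> x - \<alpha> (x + y))\<close>, whose exponents have no multilinear part. About \<open>1 / (\<epsilon> c)\<^sup>2\<close>
  suitably chosen values of \<open>y\<close> already give an \<open>L\<^sup>2\<close> approximation of this average, which is far
  better than the required bound.
\<close>

section \<open>The additive character of the prime field\<close>

text \<open>Representatives add only modulo \<open>CARD('a)\<close>; the discrepancy shifts the
  exponent by an integer multiple of 2 pi i.\<close>

lemma chi_add: "chi (a + b) = chi a * chi b"
proof -
  let ?p = "int CARD('a)"
  let ?n = "to_int_mod_ring a + to_int_mod_ring b"
  have "to_int_mod_ring (a + b) = ?n mod ?p"
    by (transfer) simp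
  then have "to_int_mod_ring (a + b) = ?n - ?p * (?n div ?p)"
    by (simp add: minus_mult_div_eq_mod)
  then have "(of_int ?n :: complex) = of_int (to_int_mod_ring (a + b)) + of_nat CARD('a) * of_int (?n div ?p)"
    by (metis add.commute add_diff_cancel_left' diff_add_cancel of_int_add of_int_mult of_int_of_nat_eq)
  then have "2 * of_real pi * \<i> * of_int ?n / of_nat CARD('a) =
      2 * of_real pi * \<i> * of_int (to_int_mod_ring (a + b)) / of_nat CARD('a)
      + of_int (2 * (?n div ?p)) * (of_real pi * \<i>)"
    by (simp add: field_simps)
  then have "exp (2 * of_real pi * \<i> * of_int ?n / of_nat CARD('a)) = chi (a + b)"
    unfolding chi_def by (simp add: exp_add exp_eq_1 sin_zero_iff)
  then show ?thesis
    unfolding chi_def by (simp add: exp_add [symmetric] field_simps)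
qed

lemma norm_chi [simp]: "cmod (chi a) = 1"
  unfolding chi_def by (simp add: norm_exp_eq_Re)

lemma chi_diff: "chi (a - b) = chi a * cnj (chi b)"
proof -
  have "chi a = chi (a - b) * chi b"
    by (simp flip: chi_add)
  then show ?thesis
    by (simp add: mult.assoc complex_norm_square [symmetric])
qed

section \<open>Multilinear forms under translation\<close>

text \<open>Each coordinate in \<open>K\<close> contributes either its x-part or its y-part, and
  \<open>J\<close> records where x was chosen. The set \<open>K\<close> is there for the induction;
  \<open>K = I\<close> expands \<open>f\<close> at x + y.\<close>

lemma multilinear_form_expand:
  assumes f: "multilinear_form smul I U f"
    and U: "\<And>i u v. i \<in> I \<Longrightarrow> u \<in> U i \<Longrightarrow> v \<in> U i \<Longrightarrow> u + v \<in> U i"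
    and K: "finite K" "K \<subseteq> I"
    and x: "x \<in> PiE I U" and y: "y \<in> PiE I U"
  shows "f (\<lambda>i\<in>I. if i \<in> K then x i + y i else y i) =
    (\<Sum>J\<in>Pow K. f (\<lambda>i\<in>I. if i \<in> J then x i else y i))"
  using K y
proof (induction K arbitrary: y rule: finite_induct)
  case empty
  then show ?case by simp
next
  case (insert a K)
  \<comment> \<open>The half with \<open>x a\<close> in coordinate \<open>a\<close> is the induction
    hypothesis at this modified point, which is why \<open>y\<close> is kept arbitrary.\<close>
  let ?y = "y(a := x a)"
  let ?g = "\<lambda>i\<in>I. if i \<in> K then x i + y i else y i"
  have a: "a \<in> I" and K: "K \<subseteq> I" using insert.prems by auto
  have xa: "x a \<in> U a" and ya: "y a \<in> U a" using a x insert.prems by auto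
  have y': "?y \<in> PiE I U"
    using insert.prems xa a by (auto simp: PiE_iff extensional_def)
  have g: "?g \<in> PiE I U"
    using x insert.prems U by (auto simp: PiE_iff)
  have "(\<lambda>i\<in>I. if i \<in> insert a K then x i + y i else y i) = ?g(a := x a + y a)"
    using a by (auto simp: fun_eq_iff)
  moreover have "f (?g(a := x a + y a)) = f (?g(a := x a)) + f (?g(a := y a))"
    using f a g xa ya unfolding multilinear_form_def linear_form_on_def by blast
  moreover have "?g(a := y a) = ?g"
    using a insert.hyps by (auto simp: fun_eq_iff)
  moreover have "?g(a := x a) = (\<lambda>i\<in>I. if i \<in> K then x i + ?y i else ?y i)"
    using a insert.hyps by (auto simp: fun_eq_iff)
  ultimately have "f (\<lambda>i\<in>I. if i \<in> insert a K then x i + y i else y i) =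
      (\<Sum>J\<in>Pow K. f (\<lambda>i\<in>I. if i \<in> J then x i else ?y i)) +
      (\<Sum>J\<in>Pow K. f (\<lambda>i\<in>I. if i \<in> J then x i else y i))"
    using insert.IH [OF K y'] insert.IH [OF K insert.prems(2)] by (simp del: restrict_apply)
  \<comment> \<open>Having \<open>x a\<close> in the base point amounts to adding \<open>a\<close>
    to \<open>J\<close>, so this half runs over the subsets of \<open>insert a K\<close> that
    contain \<open>a\<close>.\<close>
  also have "(\<Sum>J\<in>Pow K. f (\<lambda>i\<in>I. if i \<in> J then x i else ?y i)) =
      (\<Sum>J\<in>Pow K. f (\<lambda>i\<in>I. if i \<in> insert a J then x i else y i))"
    by (intro sum.cong arg_cong [where f = f]) (auto simp: fun_eq_iff)
  also have "\<dots> = (\<Sum>J\<in>insert a ` Pow K. f (\<lambda>i\<in>I. if i \<in> J then x i else y i))"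
  proof -
    have "inj_on (insert a) (Pow K)"
      using insert.hyps by (auto simp: inj_on_def)
    then show ?thesis
      by (simp add: sum.reindex)
  qed
  finally show ?case
    using insert.hyps by (subst Pow_insert, subst sum.union_disjoint) (auto simp: add.commute simp del: restrict_apply)
qed

text \<open>In the expansion of \<open>f\<close> at x + y the term \<open>J = I\<close> is
  \<open>f x\<close> and cancels. Every other term freezes at least one coordinate at
  \<open>y\<close> and is multilinear in the remaining ones.\<close>

lemma multilinear_diff_translate:
  assumes f: "multilinear_form smul I U f"
    and U: "\<And>i u v. i \<in> I \<Longrightarrow> u \<in> U i \<Longrightarrow> v \<in> U i \<Longrightarrow> u + v \<in> U i"
    and I: "finite I"
    and y: "y \<in> PiE I U"
  shows "multiaffine_form smul I U (\<lambda>x. f x - f (\<lambda>i\<in>I. x i + y i))"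
    and "vanishing_multilinear_part smul I U (\<lambda>x. f x - f (\<lambda>i\<in>I. x i + y i))"
proof -
  have lin: "linear_form_on smul (U i) (\<lambda>t. f (z(i := t)))" if "i \<in> I" "z \<in> PiE I U" for i z
    using f that unfolding multilinear_form_def by blast
  show "multiaffine_form smul I U (\<lambda>x. f x - f (\<lambda>i\<in>I. x i + y i))"
    unfolding multiaffine_form_def affine_form_on_def
  proof (intro ballI exI conjI)
    fix i x assume i: "i \<in> I" and x: "x \<in> PiE I U"
    let ?z = "\<lambda>i\<in>I. x i + y i"
    have z: "?z \<in> PiE I U" using x y U by (auto simp: PiE_iff)
    \<comment> \<open>The translated point has \<open>t + y i\<close> in coordinate
      \<open>i\<close>; additivity splits it into this linear part and a constant free of
      \<open>t\<close>.\<close>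
    show "linear_form_on smul (U i) (\<lambda>t. f (x(i := t)) - f (?z(i := t)))"
      using lin [OF i x] lin [OF i z] unfolding linear_form_on_def
      by (simp add: algebra_simps)
    fix t assume t: "t \<in> U i"
    have "(\<lambda>j\<in>I. (x(i := t)) j + y j) = ?z(i := t + y i)"
      using i by (auto simp: fun_eq_iff)
    moreover have "y i \<in> U i" using y i by auto
    ultimately show "f (x(i := t)) - f (\<lambda>j\<in>I. (x(i := t)) j + y j) =
        f (x(i := t)) - f (?z(i := t)) + (- f (?z(i := y i)))"
      using lin [OF i z] t unfolding linear_form_on_def by simp
  qed
  \<comment> \<open>These are the negated expansion terms, with the top one set to 0 because it
    cancels against \<open>f x\<close>.\<close>
  define \<beta> where "\<beta> J x = (if J = I then 0 else - f (\<lambda>i\<in>I. if i \<in> J then x i else y i))" for J x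
  have "multilinear_form smul J U (\<beta> J)" if J: "J \<subseteq> I" for J
    unfolding multilinear_form_def
  proof (intro ballI)
    fix i x assume i: "i \<in> J" and x: "x \<in> PiE J U"
    let ?z = "\<lambda>i\<in>I. if i \<in> J then x i else y i"
    have z: "?z \<in> PiE I U" using x y by (auto simp: PiE_iff)
    have "\<beta> J (x(i := t)) = (if J = I then 0 else - f (?z(i := t)))" for t
    proof -
      have "(\<lambda>j\<in>I. if j \<in> J then (x(i := t)) j else y j) = ?z(i := t)"
        using i J by (auto simp: fun_eq_iff)
      then show ?thesis by (simp add: \<beta>_def)
    qed
    then show "linear_form_on smul (U i) (\<lambda>t. \<beta> J (x(i := t)))"
      using lin [of i ?z] i J z unfolding linear_form_on_def by auto
  qed
  moreover have "f x - f (\<lambda>i\<in>I. x i + y i) = (\<Sum>J\<in>Pow I. \<beta> J (restrict x J))"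
    if x: "x \<in> PiE I U" for x
  proof -
    let ?h = "\<lambda>J. f (\<lambda>i\<in>I. if i \<in> J then x i else y i)"
    have "f (\<lambda>i\<in>I. x i + y i) = f (\<lambda>i\<in>I. if i \<in> I then x i + y i else y i)"
      by (intro arg_cong [where f = f]) (auto simp: fun_eq_iff)
    also have "\<dots> = sum ?h (Pow I)"
      by (rule multilinear_form_expand [OF f U I order_refl x y])
    also have "\<dots> = ?h I + sum ?h (Pow I - {I})"
      using I by (subst sum.remove [of _ I]) auto
    also have "?h I = f x"
      using x by (intro arg_cong [where f = f]) (auto simp: fun_eq_iff PiE_iff extensional_def)
    finally have "f x - f (\<lambda>i\<in>I. x i + y i) = (\<Sum>J\<in>Pow I - {I}. - ?h J)"
      by (simp add: sum_negf del: restrict_apply)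
    also have "\<dots> = (\<Sum>J\<in>Pow I - {I}. \<beta> J (restrict x J))"
      by (intro sum.cong) (auto simp: \<beta>_def intro!: arg_cong [where f = f])
    also have "\<dots> = (\<Sum>J\<in>Pow I. \<beta> J (restrict x J))"
      using I by (subst (2) sum.remove [of _ I]) (auto simp: \<beta>_def)
    finally show ?thesis .
  qed
  ultimately show "vanishing_multilinear_part smul I U (\<lambda>x. f x - f (\<lambda>i\<in>I. x i + y i))"
    unfolding vanishing_multilinear_part_def multilinear_decomposition_def
    by (intro exI [of _ \<beta>]) (auto simp: \<beta>_def)
qed

section \<open>Approximating a mean by few samples\<close>

lemma ex_le_average:
  fixes f :: "'a \<Rightarrow> real"
  assumes "finite Y" "Y \<noteq> {}" "sum f Y \<le> real (card Y) * C"
  shows "\<exists>y\<in>Y. f y \<le> C"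
proof (rule ccontr)
  assume "\<not> ?thesis"
  then have "(\<Sum>y\<in>Y. C) < sum f Y"
    using assms by (intro sum_strict_mono) auto
  then show False
    using assms by simp
qed

text \<open>
  The points are chosen greedily: on average over the next point the cross term vanishes, so some
  choice increases the total squared error by at most \<open>card X * M\<^sup>2\<close>.
\<close>

lemma approximate_mean_by_samples:
  fixes g :: "'a \<Rightarrow> 'b \<Rightarrow> 'c::real_inner"
  assumes Y: "finite Y" "Y \<noteq> {}"
    and mean: "\<And>x. x \<in> X \<Longrightarrow> (\<Sum>y\<in>Y. g y x) = real (card Y) *\<^sub>R \<mu> x"
    and bound: "\<And>x y. x \<in> X \<Longrightarrow> y \<in> Y \<Longrightarrow> norm (g y x) \<le> M"
  shows "\<exists>s::nat \<Rightarrow> 'a. (\<forall>i. s i \<in> Y) \<and>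
    (\<Sum>x\<in>X. (norm (\<Sum>i\<in>{1..m}. g (s i) x - \<mu> x))\<^sup>2) \<le> real m * (real (card X) * M\<^sup>2)"
proof (induction m)
  case 0
  then show ?case using Y by (auto intro!: exI [of _ "\<lambda>_. SOME y. y \<in> Y"] simp: some_in_eq)
next
  case (Suc m)
  then obtain s where s: "\<And>i. s i \<in> Y"
    and le: "(\<Sum>x\<in>X. (norm (\<Sum>i\<in>{1..m}. g (s i) x - \<mu> x))\<^sup>2) \<le> real m * (real (card X) * M\<^sup>2)"
    by blast
  define S where "S x = (\<Sum>i\<in>{1..m}. g (s i) x - \<mu> x)" for x
  let ?n = "real (card Y)"
  have avg: "(\<Sum>y\<in>Y. (norm (S x + (g y x - \<mu> x)))\<^sup>2) \<le> ?n * ((norm (S x))\<^sup>2 + M\<^sup>2)"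
    if x: "x \<in> X" for x
  proof -
    \<comment> \<open>Regrouping as \<open>(S x - \<mu> x) + g y x\<close> isolates the dependence
      on \<open>y\<close>. Inserting the mean then leaves the squared norm of \<open>S x\<close>
      minus that of \<open>\<mu> x\<close>, and the latter is dropped.\<close>
    have "(\<Sum>y\<in>Y. (norm (S x + (g y x - \<mu> x)))\<^sup>2) =
        (\<Sum>y\<in>Y. (norm (S x - \<mu> x))\<^sup>2 + 2 * inner (S x - \<mu> x) (g y x) + (norm (g y x))\<^sup>2)"
      by (intro sum.cong) (auto simp: power2_norm_eq_inner algebra_simps inner_commute)
    also have "\<dots> = ?n * (norm (S x - \<mu> x))\<^sup>2 + 2 * inner (S x - \<mu> x) (\<Sum>y\<in>Y. g y x)
        + (\<Sum>y\<in>Y. (norm (g y x))\<^sup>2)"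
      by (simp add: sum.distrib inner_sum_right sum_distrib_left)
    also have "\<dots> = ?n * ((norm (S x))\<^sup>2 - (norm (\<mu> x))\<^sup>2) + (\<Sum>y\<in>Y. (norm (g y x))\<^sup>2)"
      by (simp add: mean [OF x] power2_norm_eq_inner algebra_simps inner_commute)
    also have "\<dots> \<le> ?n * (norm (S x))\<^sup>2 + (\<Sum>y\<in>Y. M\<^sup>2)"
      using bound [OF x] by (intro add_mono mult_left_mono sum_mono power_mono) auto
    finally show ?thesis by (simp add: algebra_simps)
  qed
  \<comment> \<open>Summing over \<open>x\<close> before choosing \<open>y\<close> yields a single
    \<open>y\<close> for all \<open>x\<close> at once.\<close>
  have "(\<Sum>y\<in>Y. \<Sum>x\<in>X. (norm (S x + (g y x - \<mu> x)))\<^sup>2) \<le> (\<Sum>x\<in>X. ?n * ((norm (S x))\<^sup>2 + M\<^sup>2))"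
    by (subst sum.swap) (intro sum_mono avg)
  also have "\<dots> = ?n * ((\<Sum>x\<in>X. (norm (S x))\<^sup>2) + real (card X) * M\<^sup>2)"
    by (simp add: sum_distrib_left [symmetric] sum.distrib)
  finally obtain y where y: "y \<in> Y"
    and "(\<Sum>x\<in>X. (norm (S x + (g y x - \<mu> x)))\<^sup>2) \<le> (\<Sum>x\<in>X. (norm (S x))\<^sup>2) + real (card X) * M\<^sup>2"
    using ex_le_average [OF Y] by blast
  then have "(\<Sum>x\<in>X. (norm (S x + (g y x - \<mu> x)))\<^sup>2) \<le> real (Suc m) * (real (card X) * M\<^sup>2)"
    using le by (simp add: S_def algebra_simps)
  moreover have "(\<Sum>i\<in>{1..Suc m}. g ((s(Suc m := y)) i) x - \<mu> x) = S x + (g y x - \<mu> x)" for x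
    unfolding S_def by simp
  ultimately show ?case
    using s y by (intro exI [of _ "s(Suc m := y)"]) auto
qed

section \<open>The averaging identity and the resulting approximation\<close>

lemma chi_eq_average:
  fixes U :: "nat \<Rightarrow> 'v::ab_group_add set"
  assumes U: "\<And>i u v. i \<in> I \<Longrightarrow> u \<in> U i \<Longrightarrow> v \<in> U i \<Longrightarrow> u + v \<in> U i"
      "\<And>i u v. i \<in> I \<Longrightarrow> u \<in> U i \<Longrightarrow> v \<in> U i \<Longrightarrow> u - v \<in> U i"
    and I: "finite I" and x: "x \<in> PiE I U"
  shows "(\<Sum>y\<in>PiE I U. chi (f x - f (\<lambda>i\<in>I. x i + y i))) =
    of_nat (card (PiE I U)) * cnj (bias I U f) * chi (f x)"
\<comment> \<open>For an infinite product both the sum and \<open>card\<close> are 0 by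
  convention.\<close>
proof (cases "finite (PiE I U)")
  case True
  have "(\<Sum>y\<in>PiE I U. chi (f (\<lambda>i\<in>I. x i + y i))) = (\<Sum>z\<in>PiE I U. chi (f z))"
    by (rule sum.reindex_bij_witness [where i = "\<lambda>z. \<lambda>i\<in>I. z i - x i" and j = "\<lambda>y. \<lambda>i\<in>I. x i + y i"])
      (use x U in \<open>auto simp: PiE_iff fun_eq_iff extensional_def\<close>)
  also have "\<dots> = of_nat (card (PiE I U)) * bias I U f"
  proof -
    have "card (PiE I U) \<noteq> 0" using True x by auto
    moreover have "bias I U f = (\<Sum>z\<in>PiE I U. chi (f z)) / of_nat (card (PiE I U))"
      using I by (simp add: bias_def card_PiE)
    ultimately show ?thesis
      by (simp only: times_divide_eq_right nonzero_mult_div_cancel_left of_nat_eq_0_iff not_False_eq_True)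
  qed
  finally show ?thesis
    by (simp add: chi_diff flip: sum_distrib_left cnj_sum)
qed simp

theorem theorem7:
  fixes smul :: "'p::prime_card mod_ring \<Rightarrow> 'v::ab_group_add \<Rightarrow> 'v"
    and k :: nat
    and U :: "nat \<Rightarrow> 'v set"
    and \<alpha> :: "(nat \<Rightarrow> 'v) \<Rightarrow> 'p mod_ring"
    and c \<epsilon> :: real
  assumes "vector_space smul"
    and "\<And>i. i \<in> {1..k} \<Longrightarrow> finite_dimensional_subspace smul (U i)"
    and "c > 0"
    and "multilinear_form smul {1..k} U \<alpha>"
    and "bias {1..k} U \<alpha> \<ge> complex_of_real c"
    and "\<epsilon> > 0"
  shows "\<exists>(m::nat) (coef :: nat \<Rightarrow> complex) (L :: nat \<Rightarrow> (nat \<Rightarrow> 'v) \<Rightarrow> 'p mod_ring).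
           real m \<le> 2 ^ 25 * \<epsilon> powi (-14) * c powi (-14) \<and>
           (\<Sum>i\<in>{1..m}. cmod (coef i)) \<le> c powi (-1) \<and>
           (\<forall>i\<in>{1..m}. multiaffine_form smul {1..k} U (L i) \<and>
                        vanishing_multilinear_part smul {1..k} U (L i)) \<and>
           L2_norm (PiE {1..k} U)
             (\<lambda>x. chi (\<alpha> x) - (\<Sum>i\<in>{1..m}. coef i * chi (L i x))) \<le> \<epsilon>"
proof -
  interpret vector_space smul by (rule assms(1))
  let ?I = "{1..k}"
  define P where "P = PiE ?I U"
  \<comment> \<open>The order on complex numbers requires equal imaginary parts, so the lower bound
    by \<open>c\<close> already makes the bias real.\<close>
  define b where "b = Re (bias ?I U \<alpha>)"
  have bias: "bias ?I U \<alpha> = of_real b" and cb: "c \<le> b"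
    using assms(5) by (auto simp: less_eq_complex_def b_def complex_eq_iff)
  have b: "b > 0" using cb assms(3) by simp
  have U: "\<And>i u v. i \<in> ?I \<Longrightarrow> u \<in> U i \<Longrightarrow> v \<in> U i \<Longrightarrow> u + v \<in> U i"
      "\<And>i u v. i \<in> ?I \<Longrightarrow> u \<in> U i \<Longrightarrow> v \<in> U i \<Longrightarrow> u - v \<in> U i"
    using assms(2) unfolding finite_dimensional_subspace_def
    by (auto intro: subspace_add subspace_diff)
  \<comment> \<open>If the product were infinite, the sum in the bias would be \<open>0\<close> by convention.\<close>
  have P: "finite P" "P \<noteq> {}"
    using bias b by (auto simp: bias_def P_def intro: ccontr)
  then have card_P: "real (card P) > 0" by (simp add: card_gt_0_iff)
  \<comment> \<open>This forces \<open>c \<le> 1\<close>, needed for \<open>q \<ge> 1\<close>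
    below.\<close>
  have "cmod (bias ?I U \<alpha>) \<le> 1"
  proof -
    have "cmod (\<Sum>x\<in>P. chi (\<alpha> x)) \<le> real (card P)"
      using sum_norm_le [of P "\<lambda>x. chi (\<alpha> x)" "\<lambda>_. 1"] by simp
    moreover have "bias ?I U \<alpha> = (\<Sum>x\<in>P. chi (\<alpha> x)) / of_nat (card P)"
      by (simp add: bias_def P_def card_PiE)
    ultimately show ?thesis
      using card_P by (simp only: norm_divide) (simp add: divide_simps)
  qed
  then have c1: "c \<le> 1" using bias b cb by simp
  show ?thesis
  \<comment> \<open>For large \<epsilon> the empty sum suffices, since
    \<open>chi (\<alpha> x)\<close> has modulus 1.\<close>
  proof (cases "\<epsilon> \<ge> 1")
    case True
    have "L2_norm P (\<lambda>x. chi (\<alpha> x)) = 1"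
      using card_P by (simp add: L2_norm_def)
    then show ?thesis
      using True assms(3,6) by (intro exI [of _ 0]) (simp add: P_def)
  next
    case False
    define q where "q = 1 / (\<epsilon> * c)"
    have ec: "\<epsilon> * c \<le> 1" "\<epsilon> * c > 0"
      using False c1 assms(3,6) by (auto intro: mult_le_one)
    then have q: "q \<ge> 1" by (simp add: q_def)
    \<comment> \<open>The mean squared error of \<open>m\<close> samples will be at most 1/(b^2 m),
      hence at most 1/(c^2 m), and \<open>m\<close> at least q^2 brings this below
      \<epsilon>^2.\<close>
    define m where "m = nat \<lceil>q\<^sup>2\<rceil>"
    have m: "q\<^sup>2 \<le> real m" by (simp add: m_def of_nat_ceiling)
    have m0: "real m > 0" using m q by (smt (verit) one_le_power)
    have "real m \<le> q\<^sup>2 + 1" by (simp add: m_def)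
    \<comment> \<open>Since \<open>q \<ge> 1\<close>, both q^2 and the 1 lost to the ceiling are
      absorbed by powers of \<open>q\<close>.\<close>
    also have "\<dots> \<le> 2 * q ^ 14"
      using power_increasing [of 2 14 q] one_le_power [of q 14] q by linarith
    also have "\<dots> \<le> 2 ^ 25 * q ^ 14" using q by simp
    also have "\<dots> = 2 ^ 25 * \<epsilon> powi (-14) * c powi (-14)"
      by (simp add: q_def power_int_def power_divide power_mult_distrib divide_simps)
    finally have m_le: "real m \<le> 2 ^ 25 * \<epsilon> powi (-14) * c powi (-14)" .
    define L where "L y x = \<alpha> x - \<alpha> (\<lambda>i\<in>?I. x i + y i)" for y x
    \<comment> \<open>Division by the real number \<open>b\<close> makes
      \<open>chi (\<alpha> x)\<close> the exact mean; the samples then have modulus 1/b, the bound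
      \<open>M\<close> of the sampling lemma.\<close>
    have "(\<Sum>y\<in>P. chi (L y x) / of_real b) = real (card P) *\<^sub>R chi (\<alpha> x)" if "x \<in> P" for x
      using chi_eq_average [of ?I U x \<alpha>, unfolded bias] that U b
      by (simp add: L_def P_def scaleR_conv_of_real flip: sum_divide_distrib)
    then obtain s where s: "\<And>i. s i \<in> P"
      and le: "(\<Sum>x\<in>P. (cmod (\<Sum>i\<in>{1..m}. chi (L (s i) x) / of_real b - chi (\<alpha> x)))\<^sup>2)
        \<le> real m * (real (card P) * (1 / b)\<^sup>2)"
      using approximate_mean_by_samples [of P P "\<lambda>y x. chi (L y x) / of_real b" "\<lambda>x. chi (\<alpha> x)" "1 / b" m] P b
      by (auto simp: norm_divide)
    \<comment> \<open>The factor 1/m averages the samples and 1/b is the normalization, so the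
      moduli sum to 1/b, which is at most 1/c.\<close>
    define coef :: "nat \<Rightarrow> complex" where "coef i = 1 / of_real (b * real m)" for i
    have coef: "(\<Sum>i\<in>{1..m}. cmod (coef i)) \<le> c powi (-1)"
      using b m0 cb assms(3) by (simp add: coef_def norm_divide norm_mult power_int_def field_simps)
    have "chi (\<alpha> x) - (\<Sum>i\<in>{1..m}. coef i * chi (L (s i) x)) =
        - (\<Sum>i\<in>{1..m}. chi (L (s i) x) / of_real b - chi (\<alpha> x)) / of_real (real m)" for x
      using m0 b by (simp add: coef_def sum_subtractf field_simps flip: sum_divide_distrib sum_distrib_left)
    then have "(\<Sum>x\<in>P. (cmod (chi (\<alpha> x) - (\<Sum>i\<in>{1..m}. coef i * chi (L (s i) x))))\<^sup>2) =
        (\<Sum>x\<in>P. (cmod (\<Sum>i\<in>{1..m}. chi (L (s i) x) / of_real b - chi (\<alpha> x)))\<^sup>2) / (real m)\<^sup>2"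
      by (simp only: norm_divide norm_minus_cancel norm_of_real abs_of_nat power_divide sum_divide_distrib [of _ P])
    also have "\<dots> \<le> real m * (real (card P) * (1 / b)\<^sup>2) / (real m)\<^sup>2"
      using le by (rule divide_right_mono) simp
    also have "\<dots> = real (card P) * ((1 / b)\<^sup>2 / real m)"
      using m0 by (simp add: power2_eq_square)
    also have "\<dots> \<le> real (card P) * \<epsilon>\<^sup>2"
    proof -
      have "(1 / b)\<^sup>2 \<le> (1 / c)\<^sup>2"
        using cb assms(3) b by (intro power_mono divide_left_mono) auto
      also have "\<dots> = \<epsilon>\<^sup>2 * q\<^sup>2"
        using assms(3,6) by (simp add: q_def power_divide power_mult_distrib)
      also have "\<dots> \<le> \<epsilon>\<^sup>2 * real m" using m by (intro mult_left_mono) auto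
      finally have "(1 / b)\<^sup>2 / real m \<le> \<epsilon>\<^sup>2" using m0 by (simp only: pos_divide_le_eq)
      then show ?thesis by (intro mult_left_mono) auto
    qed
    finally have "L2_norm P (\<lambda>x. chi (\<alpha> x) - (\<Sum>i\<in>{1..m}. coef i * chi (L (s i) x))) \<le> \<epsilon>"
      unfolding L2_norm_def using card_P assms(6)
      by (intro real_le_lsqrt) (auto simp: divide_simps mult.commute)
    moreover have "multiaffine_form smul ?I U (L (s i)) \<and> vanishing_multilinear_part smul ?I U (L (s i))" for i
      using multilinear_diff_translate [OF assms(4) U(1) finite_atLeastAtMost, of "s i"] s [of i]
      by (simp add: L_def [abs_def] P_def)
    ultimately show ?thesis
      using m_le coef unfolding P_def
      by (intro exI [of _ m] exI [of _ coef] exI [of _ "\<lambda>i. L (s i)"]) blast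
  qed
qed

end
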